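(* If $n=2^k$ for some integer $k\ge 0$, then $\widehat{p}(K_{n,n})=p(K_{n,n})=n$.
   Context: $K_{n,n}$ is the complete bipartite graph with both partite sets of size $n$. An edge-coloring of a graph $G$ is any assignment of colors to its edges. A walk is closed if its two endpoints coincide, and open otherwise. A parity walk (in an edge-coloring) is a walk along which every color is used an even number of times (counting repeated traversals). A parity path is a parity walk that is a path with at least one edge. A parity edge-coloring is an edge-coloring having no parity path, and $p(G)$ is the minimum number of colors in a parity edge-coloring of $G$. A strong parity edge-coloring (spec) is an edge-coloring in which every parity walk is closed, and $\widehat{p}(G)$ is the minimum number of colors in a spec of $G$. *)

theory Defs
  imports "Graph_Theory.Kuratowski" "Graph_Theory.Vertex_Walk"
begin

(* Undirected graphs are the symmetric digraphs of Graph_Theory (locale graph). A walk is a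
   nonempty list of vertices with consecutive ones adjacent; since graphs are simple, it determines
   its edges. Colors are put on undirected edges {u,v}, so that both orientations of an edge,
   which are separate arcs, have the same color. *)

definition uedges :: "('a, 'b) pre_digraph \<Rightarrow> 'a set set" where
  "uedges G = (\<lambda>(u, v). {u, v}) ` arcs_ends G"

definition walk_edges :: "'a vwalk \<Rightarrow> 'a set list" where
  "walk_edges p = map (\<lambda>(u, v). {u, v}) (vwalk_arcs p)"

definition closed_vwalk :: "'a vwalk \<Rightarrow> bool" where
  "closed_vwalk p \<longleftrightarrow> hd p = last p"

definition parity_walk :: "('a, 'b) pre_digraph \<Rightarrow> ('a set \<Rightarrow> 'c) \<Rightarrow> 'a vwalk \<Rightarrow> bool" where
  "parity_walk G c p \<longleftrightarrow> vwalk p G \<and> (\<forall>x. even (count_list (map c (walk_edges p)) x))"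

definition parity_path :: "('a, 'b) pre_digraph \<Rightarrow> ('a set \<Rightarrow> 'c) \<Rightarrow> 'a vwalk \<Rightarrow> bool" where
  "parity_path G c p \<longleftrightarrow> parity_walk G c p \<and> vpath p G \<and> vwalk_length p \<ge> 1"

definition parity_edge_coloring :: "('a, 'b) pre_digraph \<Rightarrow> ('a set \<Rightarrow> 'c) \<Rightarrow> bool" where
  "parity_edge_coloring G c \<longleftrightarrow> \<not> (\<exists>p. parity_path G c p)"

definition strong_parity_edge_coloring ::
    "('a, 'b) pre_digraph \<Rightarrow> ('a set \<Rightarrow> 'c) \<Rightarrow> bool" where
  "strong_parity_edge_coloring G c \<longleftrightarrow> (\<forall>p. parity_walk G c p \<longrightarrow> closed_vwalk p)"

(* The numbers p(G) and p-hat(G), for finite simple G. Taking colors in nat loses nothing, as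
   finitely many colors are used; c may be arbitrary off the edges of G, and only colors
   appearing on edges are counted. The minima exist: giving all edges different colors yields a
   strong parity edge-coloring, and every strong parity edge-coloring is a parity edge-coloring. *)

definition parity_number :: "('a, 'b) pre_digraph \<Rightarrow> nat" where
  "parity_number G =
    (LEAST m. \<exists>c :: 'a set \<Rightarrow> nat. parity_edge_coloring G c \<and> card (c ` uedges G) = m)"

definition strong_parity_number :: "('a, 'b) pre_digraph \<Rightarrow> nat" where
  "strong_parity_number G =
    (LEAST m. \<exists>c :: 'a set \<Rightarrow> nat. strong_parity_edge_coloring G c \<and> card (c ` uedges G) = m)"

end

theory Submission
  imports Defs
begin

unbundle bit_operations_syntax

text \<open>
  Two edges of the same color at a common vertex form a parity path, so a parity edge-coloring is
  proper and needs at least as many colors as the largest degree, here \<open>n\<close>. Conversely, label each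
  partite set bijectively by \<open>k\<close>-bit numbers and color an edge by the XOR of the labels of its ends,
  which uses the \<open>2 ^ k\<close> \<open>k\<close>-bit numbers as colors. The XOR of the colors along a walk telescopes to
  the XOR of the labels of its endpoints. On a parity walk it vanishes, so the endpoints have equal
  labels; as the walk has even length, they also lie in the same partite set, hence coincide.
\<close>

text \<open>The head of a nonempty such list recurs in its tail, and deleting both occurrences
  preserves all parities. So the list arises from \<open>[]\<close> by inserting pairs of equal
  entries, which suits both the length and the XOR.\<close>

lemma even_count_list_induct [consumes 1, case_names Nil pair]:
  assumes "\<And>a. even (count_list xs a)"
    and "P []"
    and "\<And>x ys zs. P (ys @ zs) \<Longrightarrow> P (x # ys @ x # zs)"
  shows "P xs"
  using assms(1)
proof (induction "length xs" arbitrary: xs rule: less_induct)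
  case less
  show ?case
  proof (cases xs)
    case Nil
    then show ?thesis using assms(2) by simp
  next
    case (Cons x ws)
    with less.prems[of x] have "odd (count_list ws x)"
      by simp
    then have "x \<in> set ws"
      by (metis count_notin even_zero)
    then obtain ys zs where ws: "ws = ys @ x # zs"
      by (meson split_list)
    have "even (count_list (ys @ zs) a)" for a
      using less.prems[of a] Cons ws by (auto split: if_splits)
    then have "P (ys @ zs)"
      using less.hyps[of "ys @ zs"] Cons ws by simp
    then show ?thesis
      using assms(3) Cons ws by simp
  qed
qed

lemma even_length_if_even_count_list:
  assumes "\<And>a. even (count_list xs a)"
  shows "even (length xs)"
  using assms by (induction rule: even_count_list_induct) auto

lemma foldr_xor_append:
  fixes xs ys :: "nat list"
  shows "foldr (XOR) (xs @ ys) 0 = foldr (XOR) xs 0 XOR foldr (XOR) ys 0"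
  by (induction xs) (simp_all add: xor.assoc)

lemma foldr_xor_eq_0_if_even_count_list:
  fixes xs :: "nat list"
  assumes "\<And>a. even (count_list xs a)"
  shows "foldr (XOR) xs 0 = 0"
  using assms
proof (induction rule: even_count_list_induct)
  case (pair x ys zs)
  have "foldr (XOR) (x # ys @ x # zs) 0 = (x XOR x) XOR foldr (XOR) (ys @ zs) 0"
    by (simp only: foldr_xor_append foldr.simps comp_apply xor.assoc xor.left_commute)
  then show ?case using pair by simp
qed simp

text \<open>Being below \<open>2 ^ k\<close> means being fixed by \<open>take_bit k\<close>, and
  truncation commutes with XOR.\<close>

lemma xor_less_two_power:
  fixes a b :: nat
  assumes "a < 2 ^ k" "b < 2 ^ k"
  shows "a XOR b < 2 ^ k"
  using assms by (simp flip: take_bit_nat_eq_self_iff)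

lemma strong_parity_imp_parity_edge_coloring:
  assumes "strong_parity_edge_coloring G c"
  shows "parity_edge_coloring G c"
  unfolding parity_edge_coloring_def
proof
  assume "\<exists>p. parity_path G c p"
  then obtain p where p: "parity_walk G c p" "distinct p" "2 \<le> length p"
    by (auto simp: parity_path_def vpath_def)
  then have "hd p \<noteq> last p"
    by (cases p) auto
  with p(1) assms show False
    by (simp add: strong_parity_edge_coloring_def closed_vwalk_def)
qed

lemma (in graph) neighbors_le_colors:
  assumes "parity_edge_coloring G c"
  shows "card {v. u \<rightarrow>\<^bsub>G\<^esub> v} \<le> card (c ` uedges G)"
proof (rule card_inj_on_le)
  show "inj_on (\<lambda>v. c {u, v}) {v. u \<rightarrow>\<^bsub>G\<^esub> v}"
  proof (rule inj_onI, rule ccontr)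
    fix v w
    assume vw: "v \<in> {v. u \<rightarrow>\<^bsub>G\<^esub> v}" "w \<in> {v. u \<rightarrow>\<^bsub>G\<^esub> v}" "c {u, v} = c {u, w}" "v \<noteq> w"
    \<comment> \<open>The path below enters \<open>u\<close> from \<open>v\<close>, so the reversed
      arc is needed.\<close>
    have vu: "v \<rightarrow>\<^bsub>G\<^esub> u"
      using vw(1) sym_arcs by (auto simp: symmetric_def sym_def)
    have "vpath [v, u, w] G"
      using vu vw adj_not_same by (auto simp: vpath_def vwalk_def dest: adj_in_verts)
    then have "parity_path G c [v, u, w]"
      using vw(3) by (auto simp: parity_path_def parity_walk_def walk_edges_def vpath_def
          insert_commute)
    with assms show False
      by (auto simp: parity_edge_coloring_def)
  qed
  show "(\<lambda>v. c {u, v}) ` {v. u \<rightarrow>\<^bsub>G\<^esub> v} \<subseteq> c ` uedges G"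
    by (force simp: uedges_def)
  show "finite (c ` uedges G)"
    by (simp add: uedges_def arcs_ends_def)
qed

lemma foldr_xor_walk_edges:
  fixes h :: "'a \<Rightarrow> nat"
  assumes "vwalk p G"
    and "\<And>u v. u \<rightarrow>\<^bsub>G\<^esub> v \<Longrightarrow> c {u, v} = h u XOR h v"
  shows "foldr (XOR) (map c (walk_edges p)) 0 = h (hd p) XOR h (last p)"
  using assms(1)
proof (induction p rule: vwalk_arcs.induct)
  case (3 x y xs)
  then have "x \<rightarrow>\<^bsub>G\<^esub> y" "vwalk (y # xs) G"
    by (auto simp: vwalk_def)
  with 3 have "foldr (XOR) (map c (walk_edges (x # y # xs))) 0
      = (h x XOR h y) XOR (h y XOR h (last (y # xs)))"
    by (simp add: walk_edges_def assms(2))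
  then show ?case
    \<comment> \<open>Reassociating only at \<open>h y\<close> brings its two copies together, so
      that they cancel.\<close>
    by (simp add: xor.assoc flip: xor.assoc[of "h y" "h y"])
qed (auto simp: vwalk_def walk_edges_def)

text \<open>Every arc switches sides, so prepending one flips both the parity of the length and the
  side of the head.\<close>

lemma vwalk_bipartite_last:
  assumes "vwalk p G"
    and "arcs_ends G = U \<times> V \<union> V \<times> U" "U \<inter> V = {}" "verts G = U \<union> V"
  shows "last p \<in> U \<longleftrightarrow> (if even (length (walk_edges p)) then hd p \<in> U else hd p \<in> V)"
  using assms(1)
proof (induction p rule: vwalk_arcs.induct)
  case (3 x y xs)
  then have "x \<rightarrow>\<^bsub>G\<^esub> y" "vwalk (y # xs) G"
    by (auto simp: vwalk_def)
  with 3 assms(2,3) show ?case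
    by (auto simp: walk_edges_def)
qed (use assms(3,4) in \<open>auto simp: vwalk_def walk_edges_def\<close>)

text \<open>An upper bound on the number of colors is enough here: the degree bound later forces
  equality.\<close>

lemma complete_bipartite_strong_parity_edge_coloring:
  fixes G :: "('a, 'b) pre_digraph"
  assumes "K\<^bsub>2 ^ k,2 ^ k\<^esub> G"
  obtains c :: "'a set \<Rightarrow> nat"
    where "strong_parity_edge_coloring G c" "card (c ` uedges G) \<le> 2 ^ k"
proof -
  obtain U V where UV: "verts G = U \<union> V" "U \<inter> V = {}" "card U = 2 ^ k" "card V = 2 ^ k"
    "arcs_ends G = U \<times> V \<union> V \<times> U"
    using assms by (auto simp: complete_bipartite_digraph_def)
  have fin: "finite U" "finite V"
    using UV(3,4) by (auto intro: card_ge_0_finite)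
  obtain f where f: "bij_betw f U {..<2 ^ k :: nat}"
    using finite_same_card_bij[of U "{..<2 ^ k :: nat}"] fin UV(3) by auto
  obtain g where g: "bij_betw g V {..<2 ^ k :: nat}"
    using finite_same_card_bij[of V "{..<2 ^ k :: nat}"] fin UV(4) by auto
  \<comment> \<open>Both sides reuse the same labels, so \<open>h\<close> is injective on each side
    but not on their union.\<close>
  define h where "h x = (if x \<in> U then f x else g x)" for x
  \<comment> \<open>A color is a function of an unordered edge. An edge meets each side in exactly
    one vertex, so \<open>the_elem\<close> recovers both ends; values off the edges are
    irrelevant.\<close>
  define c where "c e = h (the_elem (e \<inter> U)) XOR h (the_elem (e \<inter> V))" for e
  have h_less: "h x < 2 ^ k" if "x \<in> verts G" for x
    using that f g UV(1) by (auto simp: h_def bij_betw_def)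
  have h_inj: "inj_on h U" "inj_on h V"
    using f g UV(2) by (auto simp: h_def bij_betw_def inj_on_def)
  have c_edge: "c {u, v} = h u XOR h v" if "u \<rightarrow>\<^bsub>G\<^esub> v" for u v
  proof -
    \<comment> \<open>Both orders are covered because an arc may start on either side.\<close>
    have "c {u, v} = h u XOR h v \<and> c {v, u} = h u XOR h v" if "u \<in> U" "v \<in> V" for u v
    proof -
      have "{u, v} \<inter> U = {u}" "{u, v} \<inter> V = {v}"
        using that UV(2) by auto
      then show ?thesis
        by (simp add: c_def insert_commute)
    qed
    then show ?thesis
      using that UV(5) by (auto simp: xor.commute)
  qed
  have "strong_parity_edge_coloring G c"
    unfolding strong_parity_edge_coloring_def closed_vwalk_def
  proof (intro allI impI)
    fix p
    assume "parity_walk G c p"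
    then have p: "vwalk p G" and even: "\<And>a. even (count_list (map c (walk_edges p)) a)"
      by (auto simp: parity_walk_def)
    have "h (hd p) XOR h (last p) = 0"
      using foldr_xor_walk_edges[of p G c h, OF p c_edge] foldr_xor_eq_0_if_even_count_list[OF even] by simp
    then have "h (hd p) = h (last p)"
      by (metis xor.assoc xor.right_neutral xor.left_neutral xor_self_eq)
    moreover have "last p \<in> U \<longleftrightarrow> hd p \<in> U"
      using vwalk_bipartite_last[OF p UV(5,2,1)] even_length_if_even_count_list[OF even] by simp
    moreover have "hd p \<in> U \<union> V" "last p \<in> U \<union> V"
      using p hd_in_set[of p] last_in_set[of p] unfolding vwalk_def UV(1) by blast+
    ultimately show "hd p = last p"
      using h_inj by (auto simp: inj_on_def)
  qed
  moreover have "c ` uedges G \<subseteq> {..<2 ^ k}"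
    using UV(1,5) by (auto simp: uedges_def c_edge intro!: xor_less_two_power h_less)
  then have "card (c ` uedges G) \<le> 2 ^ k"
    by (metis card_lessThan card_mono finite_lessThan)
  ultimately show thesis
    by (rule that)
qed

text \<open>A vertex on the side of size \<open>m\<close> has the whole other side as its
  neighborhood; \<open>m > 0\<close> provides such a vertex.\<close>

lemma complete_bipartite_colors_ge:
  assumes "K\<^bsub>m,n\<^esub> G" "m > 0" "parity_edge_coloring G c"
  shows "n \<le> card (c ` uedges G)"
proof -
  interpret graph G
    using assms(1) by (simp add: complete_bipartite_digraph_def)
  obtain U V where UV: "U \<inter> V = {}" "card U = m" "card V = n"
    "arcs_ends G = U \<times> V \<union> V \<times> U"
    using assms(1) by (auto simp: complete_bipartite_digraph_def)
  from UV(2) assms(2) obtain u where "u \<in> U"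
    by fastforce
  then have "{v. u \<rightarrow>\<^bsub>G\<^esub> v} = V"
    using UV(1,4) by auto
  then show ?thesis
    using neighbors_le_colors[OF assms(3), of u] UV(3) by simp
qed

theorem proposition4p1:
  fixes G :: "('a, 'b) pre_digraph" and n k :: nat
  assumes "n = 2 ^ k"
    and "K\<^bsub>n,n\<^esub> G"
  shows "strong_parity_number G = parity_number G \<and> parity_number G = n"
proof -
  obtain c :: "'a set \<Rightarrow> nat"
    where c: "strong_parity_edge_coloring G c" "card (c ` uedges G) \<le> n"
    using assms complete_bipartite_strong_parity_edge_coloring by blast
  have lower: "n \<le> card (d ` uedges G)" if "parity_edge_coloring G d" for d :: "'a set \<Rightarrow> nat"
    using complete_bipartite_colors_ge[OF assms(2) _ that] assms(1) by simp
  note pec = strong_parity_imp_parity_edge_coloring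
  \<comment> \<open>Strong colorings are parity edge-colorings, so the lower bound applies to
    \<open>c\<close>, and this one coloring attains both minima.\<close>
  have card: "card (c ` uedges G) = n"
    using c lower[OF pec] by (simp add: le_antisym)
  have "strong_parity_number G = n"
    unfolding strong_parity_number_def using c(1) card lower[OF pec]
    by (intro Least_equality) auto
  moreover have "parity_number G = n"
    unfolding parity_number_def using pec[OF c(1)] card lower
    by (intro Least_equality) auto
  ultimately show ?thesis
    by simp
qed

end
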